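(* Let $k\ge 1$ be an integer and let $A,B$ be nonzero real numbers. Consider the equation $$z_{n+k}=\frac{z_n}{A+Bz_n},\qquad n\ge 0.$$ If $A\neq 1$, then the equilibrium point $\bar z=0$ is asymptotically stable when $|A|>1$ and unstable when $|A|<1$. Moreover, the non-zero equilibrium point $\bar z=(1-A)/B$ is asymptotically stable when $|A|<1$ and unstable when $|A|>1$.
   Context: This is the Beverton-Holt equation $z_{n+k}=\frac{\mu K z_n}{K+(\mu-1)z_n}$ with constant growth rate $\mu$ and carrying capacity $K$, written with $A=1/\mu$, $B=(\mu-1)/(K\mu)$, where general real values are allowed. An equilibrium point is a $\bar z$ with $\bar z=\bar z/(A+B\bar z)$. It is (locally) stable if for every $\epsilon>0$ there is $\delta>0$ such that every solution $(z_n)_{n\ge 0}$ with $\sum_{i=0}^{k-1}|z_i-\bar z|<\delta$ satisfies $|z_n-\bar z|<\epsilon$ for all $n\ge 0$; it is unstable if it is not stable. Asymptotically stable is meant locally: $\bar z$ is stable and there is $\delta_0>0$ such that every solution with $\sum_{i=0}^{k-1}|z_i-\bar z|<\delta_0$ satisfies $z_n\to\bar z$ as $n\to\infty$. *)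

theory Defs
  imports Complex_Main
begin

text \<open>
  The equation z (n + k) = z n / (A + B * z n). Since division is total, with x / 0 = 0,
  a solution is explicitly required to have nonvanishing denominators, so that orbits running
  into the pole of x / (A + B * x) do not count as solutions; equilibria likewise.
\<close>

definition solution :: "nat \<Rightarrow> real \<Rightarrow> real \<Rightarrow> (nat \<Rightarrow> real) \<Rightarrow> bool" where
  "solution k A B z \<longleftrightarrow>
     (\<forall>n. A + B * z n \<noteq> 0 \<and> z (n + k) = z n / (A + B * z n))"

definition equilibrium :: "real \<Rightarrow> real \<Rightarrow> real \<Rightarrow> bool" where
  "equilibrium A B e \<longleftrightarrow> A + B * e \<noteq> 0 \<and> e = e / (A + B * e)"

definition stable :: "nat \<Rightarrow> real \<Rightarrow> real \<Rightarrow> real \<Rightarrow> bool" where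
  "stable k A B e \<longleftrightarrow>
     (\<forall>\<epsilon>>0. \<exists>\<delta>>0. \<forall>z. solution k A B z \<longrightarrow>
        (\<Sum>i<k. \<bar>z i - e\<bar>) < \<delta> \<longrightarrow> (\<forall>n. \<bar>z n - e\<bar> < \<epsilon>))"

definition unstable :: "nat \<Rightarrow> real \<Rightarrow> real \<Rightarrow> real \<Rightarrow> bool" where
  "unstable k A B e \<longleftrightarrow> \<not> stable k A B e"

definition asymptotically_stable :: "nat \<Rightarrow> real \<Rightarrow> real \<Rightarrow> real \<Rightarrow> bool" where
  "asymptotically_stable k A B e \<longleftrightarrow>
     stable k A B e \<and>
     (\<exists>\<delta>>0. \<forall>z. solution k A B z \<longrightarrow>
        (\<Sum>i<k. \<bar>z i - e\<bar>) < \<delta> \<longrightarrow> z \<longlonglongrightarrow> e)"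

end

theory Submission
  imports Defs
begin

text \<open>
  The equation decouples into \<open>k\<close> independent orbits of the Moebius map
  \<open>f x = x / (A + B * x)\<close>, whose fixed points are \<open>0\<close> and \<open>(1 - A) / B\<close>, with derivatives
  \<open>1 / A\<close> and \<open>A\<close>.

  Asymptotic stability (\<open>asymptotically_stable_if_small_multiplier\<close>) is linearised stability:
  for a Moebius map the difference quotient at a fixed point \<open>e\<close> is the explicit expression
  \<open>A / ((A + B * x) * (A + B * e))\<close>, so a derivative of absolute value below \<open>1\<close> makes \<open>f\<close> a
  contraction towards \<open>e\<close> on a small interval, and solutions converge geometrically.

  Instability needs a genuine solution that leaves a neighbourhood without ever meeting the
  pole of \<open>f\<close>. In the coordinate \<open>1 / x\<close> the map is affine with slope \<open>A\<close>, so its orbits are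
  \<open>e / (1 + c * A ^ j)\<close> with \<open>e = (1 - A) / B\<close>; these run from one fixed point to the other
  when \<open>\<bar>A\<bar> \<noteq> 1\<close>. The choice \<open>c = 1 / A ^ (2 * m)\<close> avoids the pole for either sign of \<open>A\<close>
  (\<open>heteroclinic_solution\<close>). Its value at \<open>j = 2 * m\<close> is \<open>e / 2\<close>, at distance \<open>\<bar>e\<bar> / 2\<close> from both
  fixed points, while its start is as close as desired to the repelling one for large \<open>m\<close>.
\<close>

section \<open>Stability by contraction\<close>

text \<open>
  The exponent \<open>n div k\<close> counts how often the map has been applied to reach index \<open>n\<close> from
  one of the \<open>k\<close> initial values.
\<close>
lemma solution_geometric_bound:
  assumes "k \<ge> 1" "0 \<le> c" "c \<le> 1"
    and contr: "\<And>x. \<bar>x - e\<bar> < \<rho> \<Longrightarrow> \<bar>x / (A + B * x) - e\<bar> \<le> c * \<bar>x - e\<bar>"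
    and sol: "solution k A B z"
    and S: "(\<Sum>i<k. \<bar>z i - e\<bar>) < \<rho>"
  shows "\<bar>z n - e\<bar> \<le> c ^ (n div k) * (\<Sum>i<k. \<bar>z i - e\<bar>)"
proof (induction n rule: less_induct)
  case (less n)
  let ?S = "\<Sum>i<k. \<bar>z i - e\<bar>"
  have S0: "0 \<le> ?S" by (simp add: sum_nonneg)
  show ?case
  proof (cases "n < k")
    case True
    then have "\<bar>z n - e\<bar> \<le> ?S"
      by (intro member_le_sum[where f = "\<lambda>i. \<bar>z i - e\<bar>"]) auto
    with True show ?thesis by simp
  next
    case False
    define m where "m = n - k"
    have m: "n = m + k" "m < n" using False assms(1) by (auto simp: m_def)
    have IH: "\<bar>z m - e\<bar> \<le> c ^ (m div k) * ?S" using less.IH m by blast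
    also have "\<dots> \<le> 1 * ?S"
      using assms(2,3) S0 by (intro mult_right_mono power_le_one)
    finally have "\<bar>z m - e\<bar> < \<rho>" using S by simp
    then have "\<bar>z n - e\<bar> \<le> c * \<bar>z m - e\<bar>"
      using contr sol m unfolding solution_def by metis
    also have "\<dots> \<le> c * (c ^ (m div k) * ?S)"
      using IH assms(2) by (rule mult_left_mono)
    finally show ?thesis using m assms(1) by simp
  qed
qed

lemma asymptotically_stable_if_contraction:
  assumes "k \<ge> 1" "0 \<le> c" "c < 1" "\<rho> > 0"
    and contr: "\<And>x. \<bar>x - e\<bar> < \<rho> \<Longrightarrow> \<bar>x / (A + B * x) - e\<bar> \<le> c * \<bar>x - e\<bar>"
  shows "asymptotically_stable k A B e"
proof -
  have c1: "c \<le> 1" using assms(3) by simp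
  have bound: "\<bar>z n - e\<bar> \<le> c ^ (n div k) * (\<Sum>i<k. \<bar>z i - e\<bar>)"
    if "solution k A B z" "(\<Sum>i<k. \<bar>z i - e\<bar>) < \<rho>" for z n
    using solution_geometric_bound[OF assms(1,2) c1 contr that] .
  have "stable k A B e"
    unfolding stable_def
  proof (intro allI impI)
    fix \<epsilon> :: real assume "\<epsilon> > 0"
    show "\<exists>\<delta>>0. \<forall>z. solution k A B z \<longrightarrow>
        (\<Sum>i<k. \<bar>z i - e\<bar>) < \<delta> \<longrightarrow> (\<forall>n. \<bar>z n - e\<bar> < \<epsilon>)"
    proof (intro exI[of _ "min \<epsilon> \<rho>"] conjI allI impI)
      show "0 < min \<epsilon> \<rho>" using \<open>\<epsilon> > 0\<close> assms(4) by simp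
    next
      fix z n assume sol: "solution k A B z" and S: "(\<Sum>i<k. \<bar>z i - e\<bar>) < min \<epsilon> \<rho>"
      have "\<bar>z n - e\<bar> \<le> c ^ (n div k) * (\<Sum>i<k. \<bar>z i - e\<bar>)"
        using bound sol S by simp
      also have "\<dots> \<le> 1 * (\<Sum>i<k. \<bar>z i - e\<bar>)"
        using assms(2) c1 by (intro mult_right_mono power_le_one sum_nonneg) auto
      finally show "\<bar>z n - e\<bar> < \<epsilon>" using S by simp
    qed
  qed
  moreover have "z \<longlonglongrightarrow> e"
    if sol: "solution k A B z" and S: "(\<Sum>i<k. \<bar>z i - e\<bar>) < \<rho>" for z
  proof -
    have "filterlim (\<lambda>n. n div k) sequentially sequentially"
      unfolding filterlim_at_top eventually_sequentially
      using assms(1) by (metis div_le_mono nonzero_mult_div_cancel_right not_one_le_zero)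
    then have "(\<lambda>n. c ^ (n div k)) \<longlonglongrightarrow> 0"
      using filterlim_compose[OF LIMSEQ_power_zero[of c]] assms(2,3) by simp
    then have "(\<lambda>n. c ^ (n div k) * (\<Sum>i<k. \<bar>z i - e\<bar>)) \<longlonglongrightarrow> 0"
      by (rule tendsto_mult_left_zero)
    moreover have "norm (z n - e) \<le> norm (c ^ (n div k) * (\<Sum>i<k. \<bar>z i - e\<bar>)) * 1" for n
      using bound[OF sol S, of n] by simp
    ultimately have "(\<lambda>n. z n - e) \<longlonglongrightarrow> 0"
      by (rule tendsto_0_le[OF _ always_eventually, rule_format])
    then show ?thesis by (simp add: LIM_zero_iff)
  qed
  ultimately show ?thesis
    unfolding asymptotically_stable_def using assms(4) by blast
qed

text \<open>
  The hypothesis says that the derivative \<open>A / (A + B * e)\<^sup>2\<close> of the map at \<open>e\<close> has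
  absolute value below \<open>1\<close>.
\<close>
lemma asymptotically_stable_if_small_multiplier:
  assumes "k \<ge> 1" and eq: "equilibrium A B e" and mult: "\<bar>A\<bar> < (A + B * e)\<^sup>2"
  shows "asymptotically_stable k A B e"
proof -
  define D where "D = A + B * e"
  have D0: "D \<noteq> 0" and eD: "e / D = e"
    using eq by (auto simp: equilibrium_def D_def)
  have AD: "\<bar>A\<bar> / \<bar>D\<bar> < \<bar>D\<bar>"
    using mult D0 by (simp add: D_def[symmetric] divide_less_eq power2_eq_square flip: abs_mult)
  \<comment> \<open>Any lower bound \<open>r\<close> for \<open>\<bar>A + B * x\<bar>\<close> above \<open>\<bar>A\<bar> / \<bar>D\<bar>\<close> gives a contraction, and any
      \<open>r\<close> below \<open>\<bar>D\<bar>\<close> is a lower bound near \<open>e\<close>; the midpoint serves both.\<close>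
  define r where "r = (\<bar>A\<bar> / \<bar>D\<bar> + \<bar>D\<bar>) / 2"
  have r: "\<bar>A\<bar> / \<bar>D\<bar> < r" "r < \<bar>D\<bar>" using AD unfolding r_def by argo+
  have r0: "r > 0" using r(1) by (smt (verit) divide_nonneg_nonneg)
  define c where "c = \<bar>A\<bar> / \<bar>D\<bar> / r"
  define \<rho> where "\<rho> = (\<bar>D\<bar> - r) / (\<bar>B\<bar> + 1)"
  show ?thesis
  proof (rule asymptotically_stable_if_contraction[OF assms(1)])
    show "0 \<le> c" using r0 by (simp add: c_def)
    show "c < 1" unfolding c_def using r(1) r0 by (simp only: divide_less_eq_1_pos)
    show "\<rho> > 0" using r(2) by (simp add: \<rho>_def)
  next
    fix x assume x: "\<bar>x - e\<bar> < \<rho>"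
    have "\<bar>B * (x - e)\<bar> \<le> (\<bar>B\<bar> + 1) * \<rho>"
      unfolding abs_mult using x by (intro mult_mono) auto
    also have "\<dots> = \<bar>D\<bar> - r" by (simp add: \<rho>_def)
    finally have low: "r \<le> \<bar>A + B * x\<bar>"
      unfolding D_def by (simp add: algebra_simps)
    then have nz: "A + B * x \<noteq> 0" using r0 by auto
    have "x * D - e * (A + B * x) = A * (x - e)"
      by (simp add: D_def algebra_simps)
    then have "x / (A + B * x) - e / D = A * (x - e) / (D * (A + B * x))"
      using nz D0 by (simp add: diff_frac_eq mult.commute)
    then have "x / (A + B * x) - e = A * (x - e) / (D * (A + B * x))"
      using eD by simp
    then have "\<bar>x / (A + B * x) - e\<bar> = \<bar>A\<bar> / \<bar>D\<bar> * \<bar>x - e\<bar> / \<bar>A + B * x\<bar>"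
      by (simp add: abs_mult)
    also have "\<dots> \<le> \<bar>A\<bar> / \<bar>D\<bar> * \<bar>x - e\<bar> / r"
      using low r0 by (intro divide_left_mono) auto
    finally show "\<bar>x / (A + B * x) - e\<bar> \<le> c * \<bar>x - e\<bar>" by (simp add: c_def)
  qed
qed

section \<open>Instability along heteroclinic orbits\<close>

text \<open>
  A vanishing denominator would give \<open>\<bar>A\<bar> ^ j = \<bar>A\<bar> ^ (2 * m)\<close>, hence \<open>j = 2 * m\<close>; but there
  the two summands are equal and positive. The even exponent is what excludes cancellation
  for negative \<open>A\<close>.
\<close>
lemma even_power_plus_power_nonzero:
  fixes A :: real
  assumes "A \<noteq> 0" "\<bar>A\<bar> \<noteq> 1"
  shows "A ^ (2 * m) + A ^ j \<noteq> 0"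
proof
  assume *: "A ^ (2 * m) + A ^ j = 0"
  then have "\<bar>A ^ (2 * m)\<bar> = \<bar>A ^ j\<bar>" by linarith
  then have "\<bar>A\<bar> ^ (2 * m) = \<bar>A\<bar> ^ j" by (simp only: power_abs)
  then have "2 * m = j"
    using assms by (simp add: power_inject_exp')
  with * assms(1) show False by simp
qed

text \<open>
  All \<open>k\<close> interleaved orbits are the same one, \<open>e / (1 + A ^ j / A ^ (2 * m))\<close> at its
  \<open>j\<close>-th step.
\<close>
lemma heteroclinic_solution:
  fixes A B :: real
  assumes "k \<ge> 1" "A \<noteq> 0" "B \<noteq> 0" "\<bar>A\<bar> \<noteq> 1"
  defines "e \<equiv> (1 - A) / B"
  shows "solution k A B (\<lambda>n. e * A ^ (2 * m) / (A ^ (2 * m) + A ^ (n div k)))"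
  unfolding solution_def
proof
  fix n
  define P where "P = A ^ (2 * m)"
  define q where "q = A ^ (n div k)"
  have q': "A ^ ((n + k) div k) = A * q" using assms(1) by (simp add: q_def)
  have nz: "P + q \<noteq> 0" "P + A * q \<noteq> 0"
    using even_power_plus_power_nonzero[OF assms(2,4)] unfolding P_def q_def
    by (metis, metis power_Suc)
  have Be: "B * e = 1 - A" using assms(3) by (simp add: e_def)
  have "A + B * (e * P / (P + q)) = (A * (P + q) + (B * e) * P) / (P + q)"
    using nz by (simp add: field_simps)
  also have "A * (P + q) + (B * e) * P = P + A * q"
    by (simp add: Be algebra_simps)
  finally have den: "A + B * (e * P / (P + q)) = (P + A * q) / (P + q)" .
  show "A + B * (e * A ^ (2 * m) / (A ^ (2 * m) + A ^ (n div k))) \<noteq> 0 \<and>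
      e * A ^ (2 * m) / (A ^ (2 * m) + A ^ ((n + k) div k)) =
      e * A ^ (2 * m) / (A ^ (2 * m) + A ^ (n div k)) /
        (A + B * (e * A ^ (2 * m) / (A ^ (2 * m) + A ^ (n div k))))"
    unfolding q' unfolding P_def[symmetric] q_def[symmetric] den using nz by simp
qed

text \<open>
  The hypotheses on \<open>e'\<close> say that it is the fixed point which the heteroclinic orbits
  leave: their starting points tend to \<open>e'\<close>, while their midpoints \<open>e / 2\<close> stay away from it.
\<close>
lemma unstable_if_heteroclinic_start:
  fixes A B :: real
  assumes "k \<ge> 1" "A \<noteq> 0" "B \<noteq> 0" "\<bar>A\<bar> \<noteq> 1"
  defines "e \<equiv> (1 - A) / B"
  assumes e': "e' = 0 \<or> e' = e"
    and lim: "(\<lambda>m. e * A ^ (2 * m) / (A ^ (2 * m) + 1)) \<longlonglongrightarrow> e'"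
  shows "unstable k A B e'"
  unfolding unstable_def
proof
  assume "stable k A B e'"
  have e0: "e \<noteq> 0" using assms(3,4) by (auto simp: e_def)
  then have "\<bar>e\<bar> / 2 > 0" by simp
  with \<open>stable k A B e'\<close> obtain \<delta> where "\<delta> > 0" and
    close: "\<And>z n. solution k A B z \<Longrightarrow> (\<Sum>i<k. \<bar>z i - e'\<bar>) < \<delta> \<Longrightarrow> \<bar>z n - e'\<bar> < \<bar>e\<bar> / 2"
    unfolding stable_def by blast
  have k0: "real k > 0" using assms(1) by simp
  obtain m where m: "\<bar>e * A ^ (2 * m) / (A ^ (2 * m) + 1) - e'\<bar> < \<delta> / real k"
    using LIMSEQ_D[OF lim, of "\<delta> / real k"] \<open>\<delta> > 0\<close> k0 by auto
  define z where "z = (\<lambda>n. e * A ^ (2 * m) / (A ^ (2 * m) + A ^ (n div k)))"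
  have sol: "solution k A B z"
    unfolding z_def e_def by (rule heteroclinic_solution[OF assms(1-4)])
  have "(\<Sum>i<k. \<bar>z i - e'\<bar>) = real k * \<bar>e * A ^ (2 * m) / (A ^ (2 * m) + 1) - e'\<bar>"
    by (simp add: z_def)
  also have "\<dots> < \<delta>" using m k0 by (simp add: less_divide_eq mult.commute)
  finally have "\<bar>z (2 * m * k) - e'\<bar> < \<bar>e\<bar> / 2" by (rule close[OF sol])
  moreover have "z (2 * m * k) = e / 2" using assms(1,2) by (simp add: z_def)
  ultimately show False using e' by auto
qed

lemma unstable_zero:
  fixes A B :: real
  assumes "k \<ge> 1" "A \<noteq> 0" "B \<noteq> 0" "\<bar>A\<bar> < 1"
  shows "unstable k A B 0"
proof -
  have "(\<lambda>m. (A\<^sup>2) ^ m) \<longlonglongrightarrow> 0"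
    using assms(4) by (intro LIMSEQ_power_zero) (simp add: abs_square_less_1)
  then have "(\<lambda>m. (1 - A) / B * (A\<^sup>2) ^ m / ((A\<^sup>2) ^ m + 1)) \<longlonglongrightarrow> (1 - A) / B * 0 / (0 + 1)"
    by (intro tendsto_divide tendsto_add tendsto_mult tendsto_const) auto
  then show ?thesis
    using assms by (intro unstable_if_heteroclinic_start) (auto simp: power_mult)
qed

lemma unstable_nonzero_equilibrium:
  fixes A B :: real
  assumes "k \<ge> 1" "A \<noteq> 0" "B \<noteq> 0" "\<bar>A\<bar> > 1"
  shows "unstable k A B ((1 - A) / B)"
proof -
  have "(\<lambda>m. (inverse (A\<^sup>2)) ^ m) \<longlonglongrightarrow> 0"
  proof (rule LIMSEQ_power_zero)
    have "1 < \<bar>A\<bar>\<^sup>2" using assms(4) by (rule one_less_power) simp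
    then show "norm (inverse (A\<^sup>2)) < 1" by (simp add: inverse_less_1_iff)
  qed
  then have "(\<lambda>m. (1 - A) / B / (1 + (inverse (A\<^sup>2)) ^ m)) \<longlonglongrightarrow> (1 - A) / B / (1 + 0)"
    by (intro tendsto_divide tendsto_add tendsto_mult tendsto_const) auto
  moreover have "(1 - A) / B / (1 + (inverse (A\<^sup>2)) ^ m) =
      (1 - A) / B * A ^ (2 * m) / (A ^ (2 * m) + 1)" for m
  proof -
    have "1 + inverse (A ^ (2 * m)) = (A ^ (2 * m) + 1) / A ^ (2 * m)"
      using assms(2) by (simp add: field_simps)
    then show ?thesis by (simp add: power_mult power_inverse)
  qed
  ultimately show ?thesis
    using assms by (intro unstable_if_heteroclinic_start) auto
qed

section \<open>Equilibria and their stability\<close>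

lemma nonzero_equilibrium_iff:
  assumes "B \<noteq> 0" "A \<noteq> 1"
  shows "equilibrium A B e \<and> e \<noteq> 0 \<longleftrightarrow> e = (1 - A) / B"
proof -
  have "equilibrium A B e \<and> e \<noteq> 0 \<longleftrightarrow> A + B * e = 1 \<and> e \<noteq> 0"
    by (auto simp: equilibrium_def eq_divide_eq)
  also have "\<dots> \<longleftrightarrow> e = (1 - A) / B"
    using assms by (auto simp: eq_divide_eq algebra_simps)
  finally show ?thesis .
qed

theorem theorem2p4:
  fixes k :: nat and A B :: real
  assumes "k \<ge> 1" and "A \<noteq> 0" and "B \<noteq> 0" and "A \<noteq> 1"
  shows "equilibrium A B 0
       \<and> (\<bar>A\<bar> > 1 \<longrightarrow> asymptotically_stable k A B 0)
       \<and> (\<bar>A\<bar> < 1 \<longrightarrow> unstable k A B 0)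
       \<and> (\<forall>e. equilibrium A B e \<and> e \<noteq> 0 \<longleftrightarrow> e = (1 - A) / B)
       \<and> (\<bar>A\<bar> < 1 \<longrightarrow> asymptotically_stable k A B ((1 - A) / B))
       \<and> (\<bar>A\<bar> > 1 \<longrightarrow> unstable k A B ((1 - A) / B))"
proof (intro conjI impI allI)
  show eq0: "equilibrium A B 0" using assms(2) by (simp add: equilibrium_def)
  show "asymptotically_stable k A B 0" if "\<bar>A\<bar> > 1"
  proof (rule asymptotically_stable_if_small_multiplier[OF assms(1) eq0])
    have "\<bar>A\<bar> * 1 < \<bar>A\<bar> * \<bar>A\<bar>" using that by (intro mult_strict_left_mono) auto
    then show "\<bar>A\<bar> < (A + B * 0)\<^sup>2" by (simp add: power2_eq_square)
  qed
  show "unstable k A B 0" if "\<bar>A\<bar> < 1" using unstable_zero assms(1-3) that .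
  show "(equilibrium A B e \<and> e \<noteq> 0) = (e = (1 - A) / B)" for e
    using nonzero_equilibrium_iff assms(3,4) .
  then have "equilibrium A B ((1 - A) / B)" by blast
  then show "asymptotically_stable k A B ((1 - A) / B)" if "\<bar>A\<bar> < 1"
    by (rule asymptotically_stable_if_small_multiplier[OF assms(1)]) (use that assms(3) in simp)
  show "unstable k A B ((1 - A) / B)" if "\<bar>A\<bar> > 1"
    using unstable_nonzero_equilibrium assms(1-3) that .
qed

end
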